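(* Let $I$ be a finite set and $\preceq,\trianglelefteq$ partial orders on $I$, where $\trianglelefteq$ dominates $\preceq$ by $s$ steps. Then there exist partial orders $\trianglelefteq=\lesssim_0,\lesssim_1,\ldots,\lesssim_s=\preceq$ on $I$ such that $\lesssim_{r-1}$ dominates $\lesssim_r$ by one step, for $r=1,\ldots,s$.
   Context: Let $\preceq,\trianglelefteq$ be partial orders on a finite set $I$. We say $\trianglelefteq$ dominates $\preceq$ if $i\preceq j$ implies $i\trianglelefteq j$ for all $i,j\in I$. In that case, $\trianglelefteq$ dominates $\preceq$ by $s$ steps, where $s$ is the number of pairs $(i,j)\in I\times I$ with $i\trianglelefteq j$ but $i\not\preceq j$. *)

theory Defs
  imports Main
begin

text \<open>
  A partial order on \<open>I\<close> is a relation \<open>R\<close> with \<^term>\<open>partial_order_on I R\<close>, which includes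
  \<^term>\<open>R \<subseteq> I \<times> I\<close>; thus equality of orders on \<open>I\<close> is equality of sets of pairs.
  In the definitions below the first order is the dominating (larger) one.
\<close>

definition dominates :: "'a set \<Rightarrow> 'a rel \<Rightarrow> 'a rel \<Rightarrow> bool" where
  "dominates I T P \<longleftrightarrow> (\<forall>i\<in>I. \<forall>j\<in>I. (i, j) \<in> P \<longrightarrow> (i, j) \<in> T)"

definition dominates_by :: "'a set \<Rightarrow> 'a rel \<Rightarrow> 'a rel \<Rightarrow> nat \<Rightarrow> bool" where
  "dominates_by I T P s \<longleftrightarrow>
     dominates I T P \<and> s = card {(i, j) \<in> I \<times> I. (i, j) \<in> T \<and> (i, j) \<notin> P}"

end

theory Submission
  imports Defs
begin

text \<open>
  It suffices to delete a single pair from the larger order so that a partial order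
  containing the smaller one remains; iterating this removes the \<open>s\<close> excess pairs one by one.
  Deleting \<open>(a, b)\<close> with \<open>a \<noteq> b\<close> from an order \<open>T\<close> can only destroy transitivity, and does not
  do so if \<open>b\<close> covers \<open>a\<close>, that is, if nothing lies strictly between them. So the point is
  that some pair of \<open>T - P\<close> is a covering pair of \<open>T\<close> (lemma \<open>covering_pair_outside_suborder\<close>).
\<close>

text \<open>
  Take a pair of \<open>T - P\<close> whose \<open>T\<close>-interval is smallest. A point \<open>c\<close> strictly between \<open>a\<close> and \<open>b\<close>
  would give intervals \<open>[a, c]\<close> and \<open>[c, b]\<close> inside \<open>[a, b]\<close>, the first missing \<open>b\<close> and the second
  missing \<open>a\<close> by antisymmetry. By minimality \<open>(a, c)\<close> and \<open>(c, b)\<close>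
  would both lie in \<open>P\<close>, and then so would \<open>(a, b)\<close>.
\<close>
lemma covering_pair_outside_suborder:
  assumes fin: "finite I" and T: "partial_order_on I T" and P: "trans P"
    and ne: "\<not> T \<subseteq> P"
  obtains a b where "(a, b) \<in> T - P"
    and "\<And>c. (a, c) \<in> T \<Longrightarrow> (c, b) \<in> T \<Longrightarrow> c = a \<or> c = b"
proof -
  have TI: "T \<subseteq> I \<times> I" and reflT: "refl_on I T" and transT: "trans T" and antiT: "antisym T"
    using T by (auto simp: partial_order_on_def preorder_on_def)
  define interval where "interval = (\<lambda>(a, b). {c. (a, c) \<in> T \<and> (c, b) \<in> T})"
  have "interval p \<subseteq> I" for p
    using TI by (auto simp: interval_def split: prod.splits)
  then have fin_interval: "finite (interval p)" for p
    using fin finite_subset by blast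
  from ne obtain p where "p \<in> T - P" by blast
  then obtain q where q: "q \<in> T - P"
    and q_min: "\<And>y. card (interval y) < card (interval q) \<Longrightarrow> y \<notin> T - P"
    using wfE_min[OF wf_measure[of "\<lambda>p. card (interval p)"], of p "T - P"] by auto
  obtain a b where ab: "q = (a, b)" by (cases q)
  have smaller: "y \<notin> T - P" if "interval y \<subset> interval (a, b)" for y
    using q_min[of y] psubset_card_mono[OF fin_interval that] ab by simp
  have "c = a \<or> c = b" if c: "(a, c) \<in> T" "(c, b) \<in> T" for c
  proof (rule ccontr)
    assume strict: "\<not> (c = a \<or> c = b)"
    have ends: "a \<in> interval (a, b)" "b \<in> interval (a, b)"
      using q ab TI reflT by (auto simp: interval_def dest: refl_onD)
    have "interval (a, c) \<subseteq> interval (a, b)" "b \<notin> interval (a, c)"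
      using c strict by (auto simp: interval_def intro: transD[OF transT] dest: antisymD[OF antiT])
    then have "(a, c) \<in> P"
      using smaller[of "(a, c)"] c ends by blast
    moreover have "interval (c, b) \<subseteq> interval (a, b)" "a \<notin> interval (c, b)"
      using c strict by (auto simp: interval_def intro: transD[OF transT] dest: antisymD[OF antiT])
    then have "(c, b) \<in> P"
      using smaller[of "(c, b)"] c ends by blast
    ultimately have "(a, b) \<in> P"
      using P by (rule transD[rotated])
    with q ab show False by simp
  qed
  with q ab show thesis by (intro that) auto
qed

text \<open>
  Transitivity could only fail at two remaining pairs composing to \<open>(a, b)\<close>. Their common
  point would be \<open>a\<close> or \<open>b\<close> by the covering condition, and then one of them would be
  the deleted pair \<open>(a, b)\<close> itself.
\<close>
lemma partial_order_on_remove_covering_pair: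
  assumes T: "partial_order_on I T" and "a \<noteq> b"
    and cover: "\<And>c. (a, c) \<in> T \<Longrightarrow> (c, b) \<in> T \<Longrightarrow> c = a \<or> c = b"
  shows "partial_order_on I (T - {(a, b)})"
proof -
  have "T \<subseteq> I \<times> I" "refl_on I T" "trans T" "antisym T"
    using T by (auto simp: partial_order_on_def preorder_on_def)
  moreover have "trans (T - {(a, b)})"
  proof (rule transI)
    fix x y z
    assume "(x, y) \<in> T - {(a, b)}" "(y, z) \<in> T - {(a, b)}"
    moreover from this have "(x, z) \<in> T"
      using \<open>trans T\<close> by (blast dest: transD)
    ultimately show "(x, z) \<in> T - {(a, b)}"
      using cover[of y] by auto
  qed
  ultimately show ?thesis
    using \<open>a \<noteq> b\<close> by (auto simp: partial_order_on_def preorder_on_def refl_on_def antisym_def)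
qed

lemma one_step_down:
  assumes fin: "finite I" and P: "partial_order_on I P" and T: "partial_order_on I T"
    and dom: "dominates_by I T P (Suc s)"
  obtains T' where "partial_order_on I T'" "dominates_by I T T' 1" "dominates_by I T' P s"
proof -
  have PI: "P \<subseteq> I \<times> I" "refl_on I P" "trans P"
    using P by (auto simp: partial_order_on_def preorder_on_def)
  have TI: "T \<subseteq> I \<times> I"
    using T by (auto simp: partial_order_on_def preorder_on_def)
  define E where "E U = {(i, j) \<in> I \<times> I. (i, j) \<in> U \<and> (i, j) \<notin> P}" for U
  have cardE: "card (E T) = Suc s"
    using dom by (simp add: dominates_by_def E_def)
  have "\<not> T \<subseteq> P"
  proof
    assume "T \<subseteq> P"
    then have "E T = {}" by (auto simp: E_def)
    with cardE show False by simp
  qed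
  then obtain a b where ab: "(a, b) \<in> T - P"
    and cover: "\<And>c. (a, c) \<in> T \<Longrightarrow> (c, b) \<in> T \<Longrightarrow> c = a \<or> c = b"
    using covering_pair_outside_suborder[OF fin T PI(3)] by blast
  have "a \<noteq> b"
    using ab TI PI(2) by (auto dest: refl_onD)
  then have "partial_order_on I (T - {(a, b)})"
    using partial_order_on_remove_covering_pair[OF T _ cover] by blast
  moreover have "dominates_by I T (T - {(a, b)}) 1"
  proof -
    have "{(i, j) \<in> I \<times> I. (i, j) \<in> T \<and> (i, j) \<notin> T - {(a, b)}} = {(a, b)}"
      using ab TI by auto
    then show ?thesis by (simp add: dominates_by_def dominates_def)
  qed
  moreover have "dominates_by I (T - {(a, b)}) P s"
  proof -
    have "E (T - {(a, b)}) = E T - {(a, b)}" "(a, b) \<in> E T"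
      using ab TI by (auto simp: E_def)
    then have "card (E (T - {(a, b)})) = s"
      using cardE by simp
    then show ?thesis
      using dom ab by (auto simp: dominates_by_def dominates_def E_def)
  qed
  ultimately show thesis by (rule that)
qed

theorem proposition6p5:
  fixes I :: "'a set" and P T :: "'a rel" and s :: nat
  assumes "finite I"
    and "partial_order_on I P"
    and "partial_order_on I T"
    and "dominates_by I T P s"
  shows "\<exists>L :: nat \<Rightarrow> 'a rel.
           (\<forall>r\<le>s. partial_order_on I (L r)) \<and> L 0 = T \<and> L s = P \<and>
           (\<forall>r\<in>{1..s}. dominates_by I (L (r - 1)) (L r) 1)"
  using assms(3,4)
proof (induction s arbitrary: T)
  case 0
  have "P \<subseteq> I \<times> I" "T \<subseteq> I \<times> I"
    using assms(2) 0 by (auto simp: partial_order_on_def preorder_on_def)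
  \<comment> \<open>An infinite set also has cardinality 0, so finiteness is what makes the excess empty.\<close>
  moreover have "finite {(i, j) \<in> I \<times> I. (i, j) \<in> T \<and> (i, j) \<notin> P}"
    by (rule finite_subset[of _ "I \<times> I"]) (use assms(1) in auto)
  ultimately have "T = P"
    using 0(2) by (auto simp: dominates_by_def dominates_def)
  then show ?case
    using 0(1) by auto
next
  case (Suc s)
  obtain T' where T': "partial_order_on I T'" "dominates_by I T T' 1" "dominates_by I T' P s"
    using one_step_down[OF assms(1,2) Suc.prems] by blast
  from Suc.IH[OF T'(1,3)] obtain L where
    L: "\<forall>r\<le>s. partial_order_on I (L r)" "L 0 = T'" "L s = P"
       "\<forall>r\<in>{1..s}. dominates_by I (L (r - 1)) (L r) 1"
    by blast
  let ?L = "case_nat T L"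
  have "\<forall>r\<le>Suc s. partial_order_on I (?L r)"
    using L(1) Suc.prems(1) by (auto split: nat.split)
  moreover have "dominates_by I (?L (r - 1)) (?L r) 1" if r: "r \<in> {1..Suc s}" for r
  proof -
    obtain k where k: "r = Suc k" "k \<le> s"
      using r by (cases r) auto
    show ?thesis
    proof (cases k)
      case 0
      then show ?thesis using k L(2) T'(2) by simp
    next
      case (Suc m)
      then show ?thesis using k L(4)[rule_format, of k] by simp
    qed
  qed
  ultimately show ?case
    using L(3) by (intro exI[of _ ?L]) simp
qed

end
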